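(* Let $\Gamma$ be a concave, strictly decreasing curve in the first quadrant with $x$-intercept $L>0$ and $y$-intercept $M>0$ (not necessarily equal), given as the graph of $y=f(x)$, $x\in[0,L]$. Let $C=M-f(L/2)$. (a) The number $N$ of positive-integer lattice points lying inside $\Gamma$ in the first quadrant satisfies $$N\le\operatorname{Area}(\Gamma)-\frac12C$$ provided $L\ge1$. (b) The number $N(r,s)$ of positive-integer lattice points lying inside $r\Gamma(s)$ in the first quadrant satisfies $$N(r,s)\le r^2\operatorname{Area}(\Gamma)-\frac12Crs$$ whenever $r,s>0$ and $r\ge s/L$.
   Context: $\mathbb{N}=\{1,2,3,\dots\}$. The function $f:[0,L]\to[0,M]$ is continuous, concave and strictly decreasing, with $f(0)=M$ and $f(L)=0$ (no differentiability is assumed). $\operatorname{Area}(\Gamma)$ is the area enclosed by $\Gamma$ and the coordinate axes. For $r,s>0$, the curve $r\Gamma(s)$ is the image of $\Gamma$ under $(x,y)\mapsto(rs^{-1}x,\,rsy)$, i.e. the graph of $x\mapsto rsf(sx/r)$ on $[0,rs^{-1}L]$. Lattice points are counted inside or on the curve: $$N(r,s)=\#\{(j,k)\in\mathbb{N}\times\mathbb{N}: js/r\le L,\ k\le rsf(js/r)\},\qquad N=N(1,1).$$ *)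

theory Defs
  imports "HOL-Analysis.Analysis"
begin

definition curve_region :: "(real \<Rightarrow> real) \<Rightarrow> real \<Rightarrow> (real \<times> real) set" where
  "curve_region f L = {(x, y). 0 \<le> x \<and> x \<le> L \<and> 0 \<le> y \<and> y \<le> f x}"

definition curve_area :: "(real \<Rightarrow> real) \<Rightarrow> real \<Rightarrow> real" where
  "curve_area f L = measure lebesgue (curve_region f L)"

(* The curve stretched by (x, y) \<mapsto> (r x / s, r s y) is the graph of x \<mapsto> r s f(s x / r)
   on [0, r L / s]; positive lattice points on the curve itself are counted. For r, s > 0 and f
   bounded above on [0, L] the set is finite, so card is the true count. *)
definition lattice_points :: "(real \<Rightarrow> real) \<Rightarrow> real \<Rightarrow> real \<Rightarrow> real \<Rightarrow> (nat \<times> nat) set" where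
  "lattice_points f L r s =
     {(j, k). 1 \<le> j \<and> 1 \<le> k \<and> real j * s / r \<le> L \<and> real k \<le> r * s * f (real j * s / r)}"

definition lattice_count :: "(real \<Rightarrow> real) \<Rightarrow> real \<Rightarrow> real \<Rightarrow> real \<Rightarrow> nat" where
  "lattice_count f L r s = card (lattice_points f L r s)"

end

theory Submission
  imports Defs
begin

text \<open>
  Put \<open>h = s / r\<close>. Undoing the stretch turns the lattice columns into the abscissae
  \<open>h, 2 h, \<dots>, n h\<close> under the original curve, where \<open>n = \<lfloor>L / h\<rfloor>\<close> and the \<open>j\<close>-th column
  contains at most \<open>r * s * f (j * h)\<close> points. So the count is bounded by a right-endpoint Riemann
  sum of step \<open>h\<close> for the area, scaled by \<open>r\<^sup>2\<close> since \<open>r\<^sup>2 * h = r * s\<close>.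

  As \<open>f\<close> is decreasing, this sum misses the part of the region above the steps. By concavity the
  graph lies above its chords, so over each step the missed part contains the triangle with base
  \<open>h\<close> and height \<open>f ((j - 1) * h) - f (j * h)\<close>. The heights telescope to \<open>f 0 - f (n * h)\<close>
  (\<open>right_riemann_sum_le_integral\<close>). Finally \<open>L / h \<ge> 1\<close> forces \<open>n * h \<ge> L / 2\<close>, whence
  \<open>f (n * h) \<le> f (L / 2)\<close> and the triangles have total area at least \<open>h * C / 2\<close>. Part (a) is the
  case \<open>r = s = 1\<close>.
\<close>

text \<open>Tonelli, applied to the vertical slices of the closed region.\<close>
lemma curve_area_eq_integral:
  assumes cont: "continuous_on {0..L} f" and nonneg: "\<And>x. x \<in> {0..L} \<Longrightarrow> 0 \<le> f x"
  shows "curve_area f L = integral {0..L} f"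
proof -
  let ?R = "curve_region f L"
  have "continuous_on ({0..L} \<times> UNIV) (\<lambda>z. (f (fst z) - snd z, snd z))"
    by (intro continuous_intros continuous_on_compose2[OF cont]) auto
  then have "closed ((\<lambda>z. (f (fst z) - snd z, snd z)) -` ({0..} \<times> {0..}) \<inter> ({0..L} \<times> UNIV))"
    by (intro continuous_on_closed_vimage[THEN iffD1, rule_format] closed_Times) auto
  moreover have "?R = (\<lambda>z. (f (fst z) - snd z, snd z)) -` ({0..} \<times> {0..}) \<inter> ({0..L} \<times> UNIV)"
    by (auto simp: curve_region_def)
  ultimately have meas: "?R \<in> sets borel"
    by (metis borel_closed)
  have int: "(f has_integral integral {0..L} f) {0..L}"
    by (intro integrable_integral integrable_continuous_real cont)
  have slice: "emeasure lborel (Pair x -` ?R) = ennreal (indicator {0..L} x * f x)" for x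
  proof (cases "x \<in> {0..L}")
    case True
    then have "Pair x -` ?R = {0..f x}"
      by (auto simp: curve_region_def)
    with True nonneg show ?thesis
      by simp
  next
    case False
    then have "Pair x -` ?R = {}"
      by (auto simp: curve_region_def)
    with False show ?thesis
      by simp
  qed
  have "emeasure lebesgue ?R = emeasure (lborel \<Otimes>\<^sub>M lborel) ?R"
    using meas by (simp add: lborel_prod)
  also have "\<dots> = (\<integral>\<^sup>+x. emeasure lborel (Pair x -` ?R) \<partial>lborel)"
    using meas by (intro lborel.emeasure_pair_measure_alt) (subst lborel_prod, simp)
  also have "\<dots> = ennreal (integral {0..L} f)"
    unfolding slice using nonneg int by (rule nn_integral_has_integral_lebesgue)
  finally have "emeasure lebesgue ?R = ennreal (integral {0..L} f)" .
  moreover have "0 \<le> integral {0..L} f"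
    using has_integral_nonneg[OF int nonneg] .
  ultimately show ?thesis
    by (simp add: curve_area_def measure_def)
qed

text \<open>The graph of a concave function lies above its chord, so the region below it contains a trapezoid.\<close>
lemma trapezoid_le_integral:
  fixes f :: "real \<Rightarrow> real"
  assumes "a < b" and conc: "concave_on {a..b} f" and cont: "continuous_on {a..b} f"
  shows "(b - a) * (f a + f b) / 2 \<le> integral {a..b} f"
proof -
  define m where "m = (f b - f a) / (b - a)"
  have "((\<lambda>x. f a + m * (x - a)) has_integral
      (f a * b + m * (b - a)\<^sup>2 / 2) - (f a * a + m * (a - a)\<^sup>2 / 2)) {a..b}"
    using \<open>a < b\<close>
    by (intro fundamental_theorem_of_calculus)
       (auto intro!: derivative_eq_intros simp flip: has_real_derivative_iff_has_vector_derivative)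
  moreover have "(f has_integral integral {a..b} f) {a..b}"
    by (intro integrable_integral integrable_continuous_real cont)
  moreover have "f a + m * (x - a) \<le> f x" if "x \<in> {a..b}" for x
  proof -
    let ?t = "(x - a) / (b - a)"
    have affine: "(1 - t) * u + t * v = u + t * (v - u)" for t u v :: real
      by (simp add: algebra_simps)
    have "(1 - ?t) *\<^sub>R a + ?t *\<^sub>R b = x"
      using \<open>a < b\<close> unfolding real_scaleR_def affine by simp
    moreover have "(1 - ?t) * f a + ?t * f b \<le> f ((1 - ?t) *\<^sub>R a + ?t *\<^sub>R b)"
      using that \<open>a < b\<close> by (intro concave_onD[OF conc]) auto
    ultimately show ?thesis
      unfolding affine by (simp add: m_def mult.commute)
  qed
  ultimately have "(f a * b + m * (b - a)\<^sup>2 / 2) - (f a * a + m * (a - a)\<^sup>2 / 2) \<le> integral {a..b} f"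
    by (rule has_integral_le)
  moreover have "m * (b - a)\<^sup>2 = (f b - f a) * (b - a)"
    using \<open>a < b\<close> by (simp add: m_def power2_eq_square)
  ultimately show ?thesis
    by (simp add: field_simps)
qed

text \<open>The second summand is the telescoped area of the triangles between the steps and the chords.\<close>
lemma right_riemann_sum_le_integral:
  fixes f :: "real \<Rightarrow> real"
  assumes "h > 0" and conc: "concave_on {0..L} f" and cont: "continuous_on {0..L} f"
    and "real n * h \<le> L"
  shows "h * (\<Sum>j=1..n. f (real j * h)) + h * (f 0 - f (real n * h)) / 2
    \<le> integral {0..real n * h} f"
  using \<open>real n * h \<le> L\<close>
proof (induction n)
  case 0
  then show ?case by simp
next
  case (Suc n)
  let ?a = "real n * h" and ?b = "real (Suc n) * h"
  have ab: "0 \<le> ?a" "?a < ?b" "?b - ?a = h" "?b \<le> L"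
    using \<open>h > 0\<close> Suc.prems by (auto simp: algebra_simps)
  have sub: "{?a..?b} \<subseteq> {0..L}" "{0..?b} \<subseteq> {0..L}"
    using ab by auto
  have "concave_on {?a..?b} f"
    using conc sub(1) by (auto simp: concave_on_def intro: convex_on_subset)
  with ab have "h * (f ?a + f ?b) / 2 \<le> integral {?a..?b} f"
    using trapezoid_le_integral[of ?a ?b f] continuous_on_subset[OF cont sub(1)] by simp
  moreover have "integral {0..?a} f + integral {?a..?b} f = integral {0..?b} f"
    using ab continuous_on_subset[OF cont sub(2)]
    by (intro Henstock_Kurzweil_Integration.integral_combine integrable_continuous_real) auto
  moreover have "h * (\<Sum>j=1..n. f (real j * h)) + h * (f 0 - f ?a) / 2 \<le> integral {0..?a} f"
    using ab by (intro Suc.IH) simp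
  moreover have "h * (\<Sum>j=1..Suc n. f (real j * h)) = h * (\<Sum>j=1..n. f (real j * h)) + h * f ?b"
    by (simp add: distrib_left)
  ultimately show ?case
    by (simp add: field_simps)
qed

text \<open>Columns beyond \<open>L / h\<close> are empty, and the \<open>j\<close>-th one is counted by the floor of its height.\<close>
lemma lattice_count_le_sum:
  assumes "r > 0" "s > 0" and nonneg: "\<And>x. x \<in> {0..L} \<Longrightarrow> 0 \<le> f x"
  shows "real (lattice_count f L r s)
    \<le> (\<Sum>j=1..nat \<lfloor>L / (s / r)\<rfloor>. r * s * f (real j * (s / r)))"
proof -
  define n where "n = nat \<lfloor>L / (s / r)\<rfloor>"
  let ?v = "\<lambda>j::nat. r * s * f (real j * (s / r))"
  have k_iff: "real k \<le> y \<longleftrightarrow> k \<le> nat \<lfloor>y\<rfloor>" if "1 \<le> k" for k y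
  proof -
    have "real k \<le> y \<longleftrightarrow> int k \<le> \<lfloor>y\<rfloor>"
      by (simp add: le_floor_iff)
    with that show ?thesis
      by arith
  qed
  have j_iff: "real j * s / r \<le> L \<longleftrightarrow> j \<le> n" if "1 \<le> j" for j
  proof -
    have "real j * s / r \<le> L \<longleftrightarrow> real j \<le> L / (s / r)"
      using assms(1,2) by (simp add: field_simps)
    also have "\<dots> \<longleftrightarrow> j \<le> n"
      unfolding n_def by (rule k_iff[OF that])
    finally show ?thesis .
  qed
  have "lattice_points f L r s = (SIGMA j:{1..n}. {1..nat \<lfloor>?v j\<rfloor>})"
    unfolding lattice_points_def by (auto simp: j_iff k_iff)
  then have "real (lattice_count f L r s) = (\<Sum>j=1..n. real (nat \<lfloor>?v j\<rfloor>))"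
    by (simp add: lattice_count_def)
  also have "\<dots> \<le> (\<Sum>j=1..n. ?v j)"
  proof (intro sum_mono of_nat_floor mult_nonneg_nonneg nonneg)
    show "real j * (s / r) \<in> {0..L}" if "j \<in> {1..n}" for j
      using j_iff[of j] that assms(1,2) by simp
  qed (use assms(1,2) in auto)
  finally show ?thesis
    by (simp add: n_def)
qed

lemma lattice_count_le_area_minus_triangles:
  fixes f :: "real \<Rightarrow> real"
  assumes nonneg: "\<And>x. x \<in> {0..L} \<Longrightarrow> 0 \<le> f x"
    and cont: "continuous_on {0..L} f" and conc: "concave_on {0..L} f"
    and anti: "antimono_on {0..L} f"
    and rs: "r > 0" "s > 0" "s / r \<le> L"
  shows "real (lattice_count f L r s) \<le> r\<^sup>2 * curve_area f L - (f 0 - f (L / 2)) * r * s / 2"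
proof -
  define h where "h = s / r"
  define n where "n = nat \<lfloor>L / h\<rfloor>"
  have h: "h > 0" "h \<le> L" "r\<^sup>2 * h = r * s"
    using rs by (simp_all add: h_def power2_eq_square)
  have "1 \<le> L / h"
    using h by simp
  then have "1 \<le> \<lfloor>L / h\<rfloor>"
    by simp
  moreover from this have "real n = of_int \<lfloor>L / h\<rfloor>"
    by (simp add: n_def)
  ultimately have n: "1 \<le> real n" "real n \<le> L / h" "L / h < real n + 1"
    by linarith+
  have nL: "real n * h \<le> L"
    using n(2) h(1) by (simp add: field_simps)
  have "L / h \<le> 2 * real n"
    using n by linarith
  then have "L / 2 \<le> real n * h"
    using h(1) by (simp add: field_simps)
  then have "f (real n * h) \<le> f (L / 2)"
    using nL h by (intro monotone_onD[OF anti]) auto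
  then have "h * (\<Sum>j=1..n. f (real j * h)) + h * (f 0 - f (L / 2)) / 2
      \<le> h * (\<Sum>j=1..n. f (real j * h)) + h * (f 0 - f (real n * h)) / 2"
    using h(1) by simp
  also have "\<dots> \<le> integral {0..real n * h} f"
    by (rule right_riemann_sum_le_integral[OF h(1) conc cont nL])
  also have "\<dots> \<le> integral {0..L} f"
    using nL nonneg cont
    by (intro integral_subset_le integrable_continuous_real continuous_on_subset[OF cont]) auto
  also have "\<dots> = curve_area f L"
    using curve_area_eq_integral[OF cont nonneg] by simp
  finally have "r\<^sup>2 * (h * (\<Sum>j=1..n. f (real j * h)) + h * (f 0 - f (L / 2)) / 2)
      \<le> r\<^sup>2 * curve_area f L"
    by (intro mult_left_mono) auto
  moreover have "r\<^sup>2 * (h * (\<Sum>j=1..n. f (real j * h)) + h * (f 0 - f (L / 2)) / 2)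
      = (r\<^sup>2 * h) * (\<Sum>j=1..n. f (real j * h)) + (r\<^sup>2 * h) * (f 0 - f (L / 2)) / 2"
    by (simp add: algebra_simps)
  moreover have "real (lattice_count f L r s) \<le> r * s * (\<Sum>j=1..n. f (real j * h))"
    using lattice_count_le_sum[OF rs(1,2) nonneg] by (simp add: n_def h_def sum_distrib_left)
  ultimately show ?thesis
    unfolding h(3) by (simp add: algebra_simps)
qed

theorem proposition10:
  fixes f :: "real \<Rightarrow> real" and L M C :: real
  assumes "L > 0" and "M > 0"
    and "f \<in> {0..L} \<rightarrow> {0..M}"
    and "continuous_on {0..L} f"
    and "concave_on {0..L} f"
    and "strict_antimono_on {0..L} f"
    and "f 0 = M" and "f L = 0"
    and C_def: "C = M - f (L / 2)"
  shows "(L \<ge> 1 \<longrightarrow> real (lattice_count f L 1 1) \<le> curve_area f L - C / 2) \<and>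
         (\<forall>r s. r > 0 \<and> s > 0 \<and> r \<ge> s / L \<longrightarrow>
            real (lattice_count f L r s) \<le> r\<^sup>2 * curve_area f L - C * r * s / 2)"
proof -
  have anti: "antimono_on {0..L} f"
    using assms(6) by (fastforce simp: monotone_on_def order_le_less)
  have nonneg: "0 \<le> f x" if "x \<in> {0..L}" for x
    using assms(3) that by auto
  have bound: "real (lattice_count f L r s) \<le> r\<^sup>2 * curve_area f L - C * r * s / 2"
    if "r > 0" "s > 0" "s / r \<le> L" for r s
    using lattice_count_le_area_minus_triangles[OF nonneg assms(4,5) anti that]
    by (simp add: C_def \<open>f 0 = M\<close>)
  have "s / r \<le> L" if "r > 0" "r \<ge> s / L" for r s
    using that \<open>L > 0\<close> by (simp add: field_simps)
  with bound bound[of 1 1] show ?thesis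
    by auto
qed

end
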